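(* Consider the A-RepC iteration (defined in the context) with parameters $\alpha$, $\eta>0$, $\lambda$ on an undirected connected graph $\mathcal G=(\mathcal V,\mathcal E)$ with $\mathcal V=\mathcal H\cup\mathcal B$ (honest and Byzantine nodes). Suppose that $|\mathcal N_i\cap\mathcal H|>|\mathcal N_i\cap\mathcal B|$ for all $i\in\mathcal H$, and that $\lambda\in[0,1)$. Let $\bar x_{\mathcal H}^{(t)}=\frac{1}{|\mathcal H|}\sum_{i\in\mathcal H}x_i^{(t)}$ and $\Delta_{\mathcal H}^{(t)}=\max_{i,j\in\mathcal H}\|x_i^{(t)}-x_j^{(t)}\|_\infty$. Assume that $\Delta_{\mathcal H}^{(t)}\to0$ as $t\to\infty$ and that there exist $T\ge0$ and $\gamma>0$ such that $$\left\|x_{k\to i}^{(t)}-\bar x_{\mathcal H}^{(t)}\right\|_\infty\ge\gamma,\qquad\forall t\ge T,\ i\in\mathcal H,\ k\in\mathcal N_i\cap\mathcal B.$$ If $$\gamma>\frac{1-\lambda}{\eta\, d_{\min}^{\mathcal H}},$$ then there exists a finite $T^\star\ge T$ such that $$p_{ik}^{(t)}=0,\qquad\forall t\ge T^\star,\ i\in\mathcal H,\ k\in\mathcal N_i\cap\mathcal B.$$ Moreover, as $t\to\infty$, $$p_{ij}^{(t)}\to\frac{1}{d_i^{\mathcal H}},\qquad\forall i\in\mathcal H,\ j\in\mathcal N_i\cap\mathcal H.$$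
   Context: Network. $\mathcal G=(\mathcal V,\mathcal E)$ is an undirected connected (simple) graph on $\mathcal V=\{1,\dots,n\}$; $\mathcal N_i=\{j\in\mathcal V:(i,j)\in\mathcal E\}$. $\mathcal V$ is the disjoint union of the (nonempty) set $\mathcal H$ of honest nodes and the set $\mathcal B$ of Byzantine nodes. $d_i^{\mathcal H}=|\mathcal N_i\cap\mathcal H|$ and $d_{\min}^{\mathcal H}=\min_{i\in\mathcal H}d_i^{\mathcal H}$. At each time $t=0,1,2,\dots$ every honest node $i$ holds a state $x_i^{(t)}\in\mathbb R^d$ and receives a message $x_{j\to i}^{(t)}\in\mathbb R^d$ from each neighbor $j\in\mathcal N_i$. If $j\in\mathcal H$, then $x_{j\to i}^{(t)}=x_j^{(t)}$. If $j\in\mathcal B$, then $x_{j\to i}^{(t)}$ is arbitrary (may vary arbitrarily with $t$ and with the recipient $i$). A-RepC iteration. Parameters: step size $\alpha\in(0,1]$, inverse temperature $\eta$, forgetting factor $\lambda$. Starting from arbitrary $x_i^{(0)}$ and $L_{ij}^{(-1)}=0$, for every $i\in\mathcal H$, $j\in\mathcal N_i$ and $t\ge0$: - $(\mathrm{cm}_i^{(t)})_k=\operatorname{median}\{(x_{j\to i}^{(t)})_k: j\in\mathcal N_i\}$, $k=1,\dots,d$ (coordinate-wise median of the family of received messages, with multiplicity; usual median, the average of the two middle order statistics for an even number of values); - $l_{ij}^{(t)}=\|x_{j\to i}^{(t)}-\mathrm{cm}_i^{(t)}\|_\infty$ and $L_{ij}^{(t)}=\lambda L_{ij}^{(t-1)}+l_{ij}^{(t)}$;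 - $(p_{ij}^{(t)})_{j\in\mathcal N_i}=\operatorname{sparsemax}\big((-\eta L_{ij}^{(t)})_{j\in\mathcal N_i}\big)$, where for $z\in\mathbb R^K$, $\operatorname{sparsemax}(z)=\arg\max_{p\in\Delta^{K-1}}\{p^\top z-\tfrac12\|p\|_2^2\}$ and $\Delta^{K-1}=\{p\in\mathbb R^K:p\ge0,\ \sum_i p_i=1\}$; - $x_i^{(t+1)}=(1-\alpha)x_i^{(t)}+\alpha\sum_{j\in\mathcal N_i}p_{ij}^{(t)}x_{j\to i}^{(t)}$. *)

theory Defs
  imports "HOL-Analysis.Analysis" "HOL-Library.Multiset"
begin

definition simple_graph :: "'v set \<Rightarrow> 'v rel \<Rightarrow> bool" where
  "simple_graph V E \<longleftrightarrow> finite V \<and> E \<subseteq> V \<times> V \<and> sym E \<and> irrefl E"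

definition connected_graph :: "'v set \<Rightarrow> 'v rel \<Rightarrow> bool" where
  "connected_graph V E \<longleftrightarrow> V \<noteq> {} \<and> (\<forall>u\<in>V. \<forall>v\<in>V. (u, v) \<in> E\<^sup>*)"

definition nbrs :: "'v rel \<Rightarrow> 'v \<Rightarrow> 'v set" where
  "nbrs E i = {j. (i, j) \<in> E}"

definition honest_degree :: "'v rel \<Rightarrow> 'v set \<Rightarrow> 'v \<Rightarrow> nat" where
  "honest_degree E H i = card (nbrs E i \<inter> H)"

definition min_honest_degree :: "'v rel \<Rightarrow> 'v set \<Rightarrow> nat" where
  "min_honest_degree E H = (MIN i\<in>H. honest_degree E H i)"

(* For an even number of values, the average of the two middle order statistics.
   The value on the empty multiset is irrelevant. *)
definition median_mset :: "real multiset \<Rightarrow> real" where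
  "median_mset M =
     (let xs = sorted_list_of_multiset M; m = length xs in
      if odd m then xs ! (m div 2) else (xs ! (m div 2 - 1) + xs ! (m div 2)) / 2)"

(* The multiset image keeps multiplicities: distinct indices may carry equal values. *)
definition coord_median :: "'v set \<Rightarrow> ('v \<Rightarrow> real ^ 'd) \<Rightarrow> real ^ 'd" where
  "coord_median A y = (\<chi> k. median_mset (image_mset (\<lambda>j. y j $ k) (mset_set A)))"

(* The probability simplex in the space of real vectors indexed by A, where such a vector
   is a function that is extensional on A. *)
definition prob_simplex :: "'v set \<Rightarrow> ('v \<Rightarrow> real) set" where
  "prob_simplex A = {p \<in> A \<rightarrow>\<^sub>E UNIV. (\<forall>j\<in>A. 0 \<le> p j) \<and> (\<Sum>j\<in>A. p j) = 1}"

definition sparsemax :: "'v set \<Rightarrow> ('v \<Rightarrow> real) \<Rightarrow> ('v \<Rightarrow> real)" where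
  "sparsemax A z =
     arg_max_on (\<lambda>p. (\<Sum>j\<in>A. p j * z j) - 1 / 2 * (\<Sum>j\<in>A. (p j)\<^sup>2)) (prob_simplex A)"

(* Throughout, msg t j i is the message sent from node j to node i at time t. *)

definition loss :: "'v rel \<Rightarrow> (nat \<Rightarrow> 'v \<Rightarrow> 'v \<Rightarrow> real ^ 'd) \<Rightarrow> nat \<Rightarrow> 'v \<Rightarrow> 'v \<Rightarrow> real" where
  "loss E msg t i j = infnorm (msg t j i - coord_median (nbrs E i) (\<lambda>j. msg t j i))"

(* The base case is the recursion at time 0 with zero accumulated loss at time -1. *)
primrec cum_loss ::
  "'v rel \<Rightarrow> (nat \<Rightarrow> 'v \<Rightarrow> 'v \<Rightarrow> real ^ 'd) \<Rightarrow> real \<Rightarrow> nat \<Rightarrow> 'v \<Rightarrow> 'v \<Rightarrow> real" where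
  "cum_loss E msg lam 0 i j = lam * 0 + loss E msg 0 i j"
| "cum_loss E msg lam (Suc t) i j = lam * cum_loss E msg lam t i j + loss E msg (Suc t) i j"

definition weight ::
  "'v rel \<Rightarrow> (nat \<Rightarrow> 'v \<Rightarrow> 'v \<Rightarrow> real ^ 'd) \<Rightarrow> real \<Rightarrow> real \<Rightarrow> nat \<Rightarrow> 'v \<Rightarrow> 'v \<Rightarrow> real" where
  "weight E msg eta lam t i = sparsemax (nbrs E i) (\<lambda>j. - eta * cum_loss E msg lam t i j)"

(* Messages from nodes outside H are unconstrained; only messages received by nodes in H
   matter. The initial states x 0 are unconstrained. *)
definition A_RepC_run ::
  "'v rel \<Rightarrow> 'v set \<Rightarrow> real \<Rightarrow> real \<Rightarrow> real \<Rightarrow> (nat \<Rightarrow> 'v \<Rightarrow> real ^ 'd)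
    \<Rightarrow> (nat \<Rightarrow> 'v \<Rightarrow> 'v \<Rightarrow> real ^ 'd) \<Rightarrow> bool" where
  "A_RepC_run E H alpha eta lam x msg \<longleftrightarrow>
     (\<forall>t. \<forall>i\<in>H.
        (\<forall>j \<in> nbrs E i \<inter> H. msg t j i = x t j) \<and>
        x (Suc t) i = (1 - alpha) *\<^sub>R x t i
          + alpha *\<^sub>R (\<Sum>j\<in>nbrs E i. weight E msg eta lam t i j *\<^sub>R msg t j i))"

definition honest_mean :: "'v set \<Rightarrow> (nat \<Rightarrow> 'v \<Rightarrow> real ^ 'd) \<Rightarrow> nat \<Rightarrow> real ^ 'd" where
  "honest_mean H x t = (1 / real (card H)) *\<^sub>R (\<Sum>i\<in>H. x t i)"

definition honest_diameter :: "'v set \<Rightarrow> (nat \<Rightarrow> 'v \<Rightarrow> real ^ 'd) \<Rightarrow> nat \<Rightarrow> real" where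
  "honest_diameter H x t = (MAX (i, j)\<in>H \<times> H. infnorm (x t i - x t j))"

end

theory Submission
  imports Defs
begin

text \<open>
  Why the Byzantine weights die out. Each honest node hears a strict honest majority, so every
  coordinate of its median lies between honest values (\<open>infnorm_coord_median_le\<close>). With
  \<open>\<Delta>\<close> the honest diameter, the median is therefore within \<open>\<Delta>\<close> of every
  honest state and of the honest mean: honest losses are at most \<open>\<Delta>\<close>, and from time
  \<open>T\<close> on Byzantine losses are at least \<open>\<gamma> - \<Delta>\<close>. Discounted accumulation
  multiplies a constant loss by \<open>1 / (1 - \<lambda>)\<close> in the long run
  (\<open>discounted_eventually_gt\<close>), so accumulated honest losses tend to 0 while accumulated
  Byzantine losses eventually exceed a constant \<open>K > 1 / (\<eta> d)\<close>, where \<open>d\<close> is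
  the honest degree of the node.

  Sparsemax subtracts one threshold \<open>\<tau>\<close> from all scores and truncates at 0
  (\<open>sparsemax_eq_threshold\<close>). If only the honest scores survive, the normalisation forces
  \<open>\<tau>\<close> to be (sum of the honest scores \<open>- 1) / d\<close>, which tends to
  \<open>- 1 / d\<close>. Honest scores tend to 0, hence lie above \<open>\<tau>\<close> eventually;
  Byzantine scores are below \<open>- \<eta> K < - 1 / d\<close>, hence lie below it. So this guess of the
  support is eventually the right one (\<open>eventually_sparsemax_supported\<close>): Byzantine weights
  vanish and honest weights, being score minus \<open>\<tau>\<close>, tend to \<open>1 / d\<close>. The
  lower bound on \<open>\<gamma>\<close> in terms of the minimal honest degree is what makes the constant
  \<open>K\<close> available at every honest node.
\<close>

section \<open>Medians of families with a controlled majority\<close>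

lemma sorted_nth_ge:
  fixes a :: "'a::linorder"
  assumes "sorted xs" "i < length xs" "length (filter (\<lambda>v. v < a) xs) \<le> i"
  shows "a \<le> xs ! i"
proof (rule ccontr)
  assume "\<not> a \<le> xs ! i"
  then have "{..i} \<subseteq> {j. j < length xs \<and> xs ! j < a}"
    using assms(1,2) by (auto intro: le_less_trans sorted_nth_mono)
  then have "card {..i} \<le> card {j. j < length xs \<and> xs ! j < a}"
    by (intro card_mono) auto
  then show False
    using assms(3) by (simp add: length_filter_conv_card)
qed

lemma sorted_nth_le:
  fixes b :: "'a::linorder"
  assumes "sorted xs" "i + length (filter (\<lambda>v. b < v) xs) < length xs"
  shows "xs ! i \<le> b"
proof (rule ccontr)
  assume "\<not> xs ! i \<le> b"
  then have "{i..<length xs} \<subseteq> {j. j < length xs \<and> b < xs ! j}"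
    using assms(1) by (auto simp: not_le dest: sorted_nth_mono intro: order.strict_trans2)
  then have "card {i..<length xs} \<le> card {j. j < length xs \<and> b < xs ! j}"
    by (intro card_mono) auto
  then show False
    using assms(2) by (simp add: length_filter_conv_card)
qed

text \<open>
  Fewer than half of the entries lie below \<open>a\<close>, and fewer than half lie above
  \<open>b\<close>; both middle positions of the sorted list are thus out of reach of these entries.
\<close>
lemma median_mset_between:
  assumes lo: "2 * size (filter_mset (\<lambda>v. v < a) M) < size M"
    and hi: "2 * size (filter_mset (\<lambda>v. b < v) M) < size M"
  shows "a \<le> median_mset M \<and> median_mset M \<le> b"
proof -
  define xs where "xs = sorted_list_of_multiset M"
  have M: "mset xs = M" and sorted: "sorted xs"
    by (simp_all add: xs_def)
  define m where "m = length xs"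
  have lo': "2 * length (filter (\<lambda>v. v < a) xs) < m"
    and hi': "2 * length (filter (\<lambda>v. b < v) xs) < m"
    using lo hi by (simp_all add: m_def flip: M mset_filter)
  have between: "a \<le> xs ! i \<and> xs ! i \<le> b" if "2 * i = m \<or> 2 * i + 1 = m \<or> 2 * i + 2 = m" for i
    using that lo' hi' unfolding m_def
    by (intro conjI sorted_nth_ge[OF sorted] sorted_nth_le[OF sorted]; linarith)
  show ?thesis
  proof (cases "odd m")
    case True
    then have "2 * (m div 2) + 1 = m"
      by simp
    with between[of "m div 2"] True show ?thesis
      by (simp add: median_mset_def Let_def flip: xs_def m_def)
  next
    case False
    then have "2 * (m div 2) = m" "2 * (m div 2 - 1) + 2 = m"
      using lo' by auto
    with between[of "m div 2"] between[of "m div 2 - 1"] False show ?thesis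
      by (simp add: median_mset_def Let_def flip: xs_def m_def)
  qed
qed

lemma median_image_mset_between:
  assumes "finite A" "G \<subseteq> A" "card (A - G) < card G"
    and bounds: "\<And>j. j \<in> G \<Longrightarrow> a \<le> f j \<and> f j \<le> b"
  shows "a \<le> median_mset (image_mset f (mset_set A)) \<and>
         median_mset (image_mset f (mset_set A)) \<le> b"
proof -
  have "card A = card G + card (A - G)"
    using assms(1,2) by (metis card_Diff_subset card_mono finite_subset le_add_diff_inverse)
  moreover have "card {j \<in> A. f j < a} \<le> card (A - G)" "card {j \<in> A. b < f j} \<le> card (A - G)"
    using assms(1) by (auto intro!: card_mono dest: bounds)
  ultimately show ?thesis
    using assms(1,3)
    by (intro median_mset_between) (simp_all add: filter_mset_image_mset comp_def)
qed

lemma infnorm_le_cart: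
  fixes v :: "real ^ 'd"
  assumes "\<And>k. \<bar>v $ k\<bar> \<le> r"
  shows "infnorm v \<le> r"
  unfolding infnorm_cart using assms by (intro cSup_least) auto

text \<open>
  A ball of the maximum norm is a product of intervals, so a coordinate-wise median cannot leave a
  ball that contains a strict majority of the points.
\<close>
lemma infnorm_coord_median_le:
  fixes y :: "'v \<Rightarrow> real ^ 'd"
  assumes "finite A" "G \<subseteq> A" "card (A - G) < card G"
    and near: "\<And>j. j \<in> G \<Longrightarrow> infnorm (y j - w) \<le> r"
  shows "infnorm (coord_median A y - w) \<le> r"
proof (rule infnorm_le_cart)
  fix k
  have "w $ k - r \<le> y j $ k \<and> y j $ k \<le> w $ k + r" if "j \<in> G" for j
    using component_le_infnorm_cart[of "y j - w" k] near[OF that] by (simp add: abs_le_iff)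
  from median_image_mset_between[where f = "\<lambda>j. y j $ k", OF assms(1-3) this]
  show "\<bar>(coord_median A y - w) $ k\<bar> \<le> r"
    by (simp add: coord_median_def abs_le_iff)
qed

section \<open>Distances among the honest states\<close>

lemma infnorm_diff_le_honest_diameter:
  assumes "finite H" "i \<in> H" "j \<in> H"
  shows "infnorm (x t i - x t j) \<le> honest_diameter H x t"
  unfolding honest_diameter_def using assms by (intro Max_ge) auto

lemma infnorm_sum_le: "infnorm (\<Sum>i\<in>I. f i) \<le> (\<Sum>i\<in>I. infnorm (f i))"
  by (induction I rule: infinite_finite_induct)
    (auto simp: infnorm_0 intro: order_trans[OF infnorm_triangle])

lemma infnorm_diff_honest_mean_le:
  assumes "finite H" "j \<in> H"
  shows "infnorm (x t j - honest_mean H x t) \<le> honest_diameter H x t"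
proof -
  have pos: "card H > 0"
    using assms by (auto simp: card_gt_0_iff)
  then have "x t j - honest_mean H x t = (1 / real (card H)) *\<^sub>R (\<Sum>i\<in>H. x t j - x t i)"
    by (simp add: honest_mean_def sum_subtractf scaleR_diff_right sum_constant_scaleR
        del: sum_constant)
  also have "infnorm \<dots> = (1 / real (card H)) * infnorm (\<Sum>i\<in>H. x t j - x t i)"
    by (simp add: infnorm_mul)
  also have "\<dots> \<le> (1 / real (card H)) * (\<Sum>i\<in>H. honest_diameter H x t)"
    using assms
    by (intro mult_left_mono order_trans[OF infnorm_sum_le] sum_mono
        infnorm_diff_le_honest_diameter) auto
  also have "\<dots> = honest_diameter H x t"
    using pos by simp
  finally show ?thesis .
qed

section \<open>Discounted accumulation\<close>

text \<open>
  The constant \<open>c / (1 - lam)\<close> is the fixed point of \<open>u \<mapsto> lam * u + c\<close>, and the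
  deficit of \<open>u\<close> below it contracts by the factor \<open>lam\<close> in each step. The
  fixed point exceeds \<open>K\<close>, so the deficit eventually fits into the gap.
\<close>
lemma discounted_eventually_gt:
  fixes u v :: "nat \<Rightarrow> real"
  assumes rec: "\<And>t. u (Suc t) = lam * u t + v (Suc t)"
    and lam: "0 \<le> lam" "lam < 1"
    and v: "eventually (\<lambda>t. c \<le> v t) sequentially"
    and K: "K * (1 - lam) < c"
  shows "eventually (\<lambda>t. K < u t) sequentially"
proof -
  define fp where "fp = c / (1 - lam)"
  have fp: "fp = lam * fp + c" and "K < fp"
    using lam K by (simp_all add: fp_def field_simps)
  obtain N where N: "\<And>t. t \<ge> N \<Longrightarrow> c \<le> v t"
    using v by (auto simp: eventually_sequentially)
  have lower: "fp + lam ^ s * (u N - fp) \<le> u (s + N)" for s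
  proof (induction s)
    case (Suc s)
    have "fp + lam ^ Suc s * (u N - fp) = lam * (fp + lam ^ s * (u N - fp)) + c"
      by (subst (1) fp) (simp add: algebra_simps)
    also have "\<dots> \<le> lam * u (s + N) + v (Suc (s + N))"
      using Suc lam N[of "Suc (s + N)"] by (intro add_mono mult_left_mono) auto
    finally show ?case
      by (simp add: rec)
  qed simp
  have "(\<lambda>s. fp + lam ^ s * (u N - fp)) \<longlonglongrightarrow> fp + 0 * (u N - fp)"
    using lam by (intro tendsto_intros) auto
  then have "eventually (\<lambda>s. K < fp + lam ^ s * (u N - fp)) sequentially"
    using \<open>K < fp\<close> by (intro order_tendstoD) auto
  then have "eventually (\<lambda>s. K < u (s + N)) sequentially"
    by eventually_elim (use lower less_le_trans in blast)
  then show ?thesis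
    by (rule eventually_sequentially_seg[THEN iffD1])
qed

lemma discounted_tendsto_0:
  fixes u v :: "nat \<Rightarrow> real"
  assumes rec: "\<And>t. u (Suc t) = lam * u t + v (Suc t)"
    and lam: "0 \<le> lam" "lam < 1"
    and v: "v \<longlonglongrightarrow> 0"
  shows "u \<longlonglongrightarrow> 0"
proof (rule order_tendstoI)
  fix K :: real assume "K < 0"
  then have neg: "K * (1 - lam) < 0"
    using lam by (simp add: mult_neg_pos)
  then have "eventually (\<lambda>t. K * (1 - lam) / 2 \<le> v t) sequentially"
    using order_tendstoD(1)[OF v, of "K * (1 - lam) / 2"] by (auto elim: eventually_mono)
  then show "eventually (\<lambda>t. K < u t) sequentially"
    by (rule discounted_eventually_gt[where u = u and v = v, OF rec lam]) (use neg in linarith)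
next
  fix K :: real assume "0 < K"
  then have pos: "0 < K * (1 - lam)"
    using lam by simp
  have "eventually (\<lambda>t. - (K * (1 - lam) / 2) \<le> - v t) sequentially"
    using order_tendstoD(2)[OF v, of "K * (1 - lam) / 2"] pos by (auto elim: eventually_mono)
  moreover have "- u (Suc t) = lam * - u t + - v (Suc t)" for t
    by (simp add: rec)
  moreover have "- K * (1 - lam) < - (K * (1 - lam) / 2)"
    using pos by simp
  ultimately have "eventually (\<lambda>t. - K < - u t) sequentially"
    using lam
    by (intro discounted_eventually_gt[where u = "\<lambda>t. - u t" and v = "\<lambda>t. - v t"])
  then show "eventually (\<lambda>t. u t < K) sequentially"
    by simp
qed

section \<open>Sparsemax as a thresholding\<close>

text \<open>
  The objective at \<open>p\<close> minus the objective at a competitor \<open>q\<close> equals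
  \<open>1/2 * norm (p - q)^2\<close> plus the scalar product of \<open>p - q\<close> and \<open>z - p\<close>.
  Now \<open>z - p\<close> is equal to \<open>\<tau>\<close> on the support of \<open>p\<close> and at most
  \<open>\<tau>\<close> elsewhere, and \<open>p\<close>, \<open>q\<close> both have total mass 1, so the scalar
  product is nonnegative. Hence \<open>p\<close> is a maximiser, and the only one.
\<close>
lemma sparsemax_eq_threshold:
  fixes z p :: "'v \<Rightarrow> real"
  assumes p: "p \<in> prob_simplex A"
    and thr: "\<And>j. j \<in> A \<Longrightarrow> p j = max 0 (z j - \<tau>)"
  shows "sparsemax A z = p"
proof -
  define f where "f q = (\<Sum>j\<in>A. q j * z j) - 1 / 2 * (\<Sum>j\<in>A. (q j)\<^sup>2)" for q :: "'v \<Rightarrow> real"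
  have "finite A"
    using p by (auto simp: prob_simplex_def intro: ccontr)
  have less: "f q < f p" if q: "q \<in> prob_simplex A" and "q \<noteq> p" for q
  proof -
    obtain j where j: "j \<in> A" "p j \<noteq> q j"
      using q p \<open>q \<noteq> p\<close> unfolding prob_simplex_def by (metis (no_types, lifting) PiE_ext mem_Collect_eq)
    have "0 < (\<Sum>j\<in>A. (p j - q j)\<^sup>2)"
      using \<open>finite A\<close> j by (intro sum_pos2[of A j]) auto
    moreover have "(\<Sum>j\<in>A. (p j - q j) * \<tau>) \<le> (\<Sum>j\<in>A. (p j - q j) * (z j - p j))"
    proof (rule sum_mono)
      fix j assume "j \<in> A"
      then have "0 \<le> q j"
        using q by (simp add: prob_simplex_def)
      show "(p j - q j) * \<tau> \<le> (p j - q j) * (z j - p j)"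
      proof (cases "z j \<le> \<tau>")
        case True
        then show ?thesis
          using thr[OF \<open>j \<in> A\<close>] \<open>0 \<le> q j\<close> by (simp add: mult_left_mono)
      next
        case False
        then show ?thesis
          using thr[OF \<open>j \<in> A\<close>] by simp
      qed
    qed
    moreover have "(\<Sum>j\<in>A. (p j - q j) * \<tau>) = 0"
      using p q by (simp add: prob_simplex_def sum_subtractf flip: sum_distrib_right)
    moreover have "f p - f q = (\<Sum>j\<in>A. (p j - q j) * (z j - p j)) + 1 / 2 * (\<Sum>j\<in>A. (p j - q j)\<^sup>2)"
      unfolding f_def sum_distrib_left
      by (simp add: sum_subtractf[symmetric] sum.distrib[symmetric])
        (intro sum.cong refl, simp add: field_simps power2_eq_square)
    ultimately show ?thesis
      by linarith
  qed
  have "is_arg_max f (\<lambda>q. q \<in> prob_simplex A) p"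
    using p less unfolding is_arg_max_def by (metis less_asym')
  then have "is_arg_max f (\<lambda>q. q \<in> prob_simplex A) (arg_max f (\<lambda>q. q \<in> prob_simplex A))"
    unfolding arg_max_def by (rule someI[where P = "is_arg_max f (\<lambda>q. q \<in> prob_simplex A)"])
  then have "arg_max f (\<lambda>q. q \<in> prob_simplex A) = p"
    using p less by (auto simp: is_arg_max_def)
  then show ?thesis
    by (simp add: sparsemax_def arg_max_on_def f_def[abs_def])
qed

text \<open>
  The normalisation determines the threshold once the support is known; the two inequalities
  say that the guess of the support is consistent with that threshold.
\<close>
lemma sparsemax_supported:
  fixes z :: "'v \<Rightarrow> real"
  assumes A: "finite A" and S: "S \<subseteq> A" "S \<noteq> {}"
    and \<tau>: "\<tau> = ((\<Sum>j\<in>S. z j) - 1) / real (card S)"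
    and above: "\<And>j. j \<in> S \<Longrightarrow> \<tau> \<le> z j"
    and below: "\<And>j. j \<in> A - S \<Longrightarrow> z j \<le> \<tau>"
  shows "sparsemax A z = (\<lambda>j\<in>A. if j \<in> S then z j - \<tau> else 0)" (is "_ = ?p")
proof (rule sparsemax_eq_threshold)
  have "card S > 0"
    using A S by (auto simp: card_gt_0_iff intro: finite_subset)
  have "(\<Sum>j\<in>A. ?p j) = (\<Sum>j\<in>S. z j - \<tau>)"
    using S A by (simp add: sum.If_cases Int_absorb1)
  also have "\<dots> = 1"
    using \<open>card S > 0\<close> by (simp add: sum_subtractf \<tau>)
  finally show "?p \<in> prob_simplex A"
    using above by (auto simp: prob_simplex_def)
  show "?p j = max 0 (z j - \<tau>)" if "j \<in> A" for j
    using that above[of j] below[of j] by (auto simp: max_def)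
qed

text \<open>
  Scores on \<open>S\<close> that tend to 0 give a threshold tending to \<open>- 1 / card S\<close>. Scores
  outside \<open>S\<close> only have to stay below a level strictly under this limit: they may diverge
  or oscillate.
\<close>
lemma eventually_sparsemax_supported:
  fixes z :: "nat \<Rightarrow> 'v \<Rightarrow> real"
  assumes A: "finite A" and S: "S \<subseteq> A" "S \<noteq> {}"
    and vanish: "\<And>j. j \<in> S \<Longrightarrow> (\<lambda>t. z t j) \<longlonglongrightarrow> 0"
    and low: "\<And>k. k \<in> A - S \<Longrightarrow> eventually (\<lambda>t. z t k < m) sequentially"
    and m: "m < - (1 / real (card S))"
  shows "eventually (\<lambda>t. \<forall>k\<in>A - S. sparsemax A (z t) k = 0) sequentially"
    and "j \<in> S \<Longrightarrow> (\<lambda>t. sparsemax A (z t) j) \<longlonglongrightarrow> 1 / real (card S)"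
proof -
  have "finite S"
    using A S by (auto intro: finite_subset)
  then have "card S > 0"
    using S by (simp add: card_gt_0_iff)
  define \<tau> where "\<tau> t = ((\<Sum>j\<in>S. z t j) - 1) / real (card S)" for t
  have "\<tau> \<longlonglongrightarrow> ((\<Sum>j\<in>S. 0) - 1) / real (card S)"
    unfolding \<tau>_def using \<open>card S > 0\<close> by (intro tendsto_intros vanish) auto
  then have \<tau>_lim: "\<tau> \<longlonglongrightarrow> - (1 / real (card S))"
    by simp
  have "eventually (\<lambda>t. \<forall>j\<in>S. \<tau> t < z t j) sequentially"
  proof (rule eventually_ball_finite[OF \<open>finite S\<close>], rule ballI)
    fix j assume "j \<in> S"
    have "(\<lambda>t. z t j - \<tau> t) \<longlonglongrightarrow> 0 - - (1 / real (card S))"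
      by (intro tendsto_diff vanish \<tau>_lim \<open>j \<in> S\<close>)
    then have "eventually (\<lambda>t. 0 < z t j - \<tau> t) sequentially"
      using \<open>card S > 0\<close> by (intro order_tendstoD) auto
    then show "eventually (\<lambda>t. \<tau> t < z t j) sequentially"
      by simp
  qed
  moreover have "eventually (\<lambda>t. \<forall>k\<in>A - S. z t k < m) sequentially"
    using A low by (intro eventually_ball_finite) auto
  moreover have "eventually (\<lambda>t. m < \<tau> t) sequentially"
    using \<tau>_lim m by (rule order_tendstoD)
  ultimately have ev: "eventually (\<lambda>t. sparsemax A (z t) =
      (\<lambda>j\<in>A. if j \<in> S then z t j - \<tau> t else 0)) sequentially"
  proof eventually_elim
    case (elim t)
    have "z t k \<le> \<tau> t" if "k \<in> A - S" for k
      using elim that by (meson less_imp_le less_trans)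
    then show ?case
      using elim(1) by (intro sparsemax_supported[OF A S \<tau>_def]) (auto intro: less_imp_le)
  qed
  then show "eventually (\<lambda>t. \<forall>k\<in>A - S. sparsemax A (z t) k = 0) sequentially"
    by eventually_elim simp
  assume "j \<in> S"
  have "eventually (\<lambda>t. z t j - \<tau> t = sparsemax A (z t) j) sequentially"
    using ev by eventually_elim (use S \<open>j \<in> S\<close> in auto)
  moreover have "(\<lambda>t. z t j - \<tau> t) \<longlonglongrightarrow> 0 - - (1 / real (card S))"
    by (intro tendsto_diff vanish \<tau>_lim \<open>j \<in> S\<close>)
  ultimately show "(\<lambda>t. sparsemax A (z t) j) \<longlonglongrightarrow> 1 / real (card S)"
    by (auto intro: Lim_transform_eventually)
qed

section \<open>Losses and weights at one honest node\<close>

text \<open>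
  The median is the pivot of two comparisons: it is within the honest diameter of each honest state,
  which bounds honest losses from above, and of the honest mean, from which Byzantine messages keep
  their distance, which bounds Byzantine losses from below.
\<close>
lemma weights_at_honest_node:
  fixes x :: "nat \<Rightarrow> 'v \<Rightarrow> real ^ 'd" and msg :: "nat \<Rightarrow> 'v \<Rightarrow> 'v \<Rightarrow> real ^ 'd"
  assumes fin: "finite (nbrs E i)" "finite H"
    and majority: "card (nbrs E i - H) < card (nbrs E i \<inter> H)"
    and honest_msg: "\<And>t j. j \<in> nbrs E i \<inter> H \<Longrightarrow> msg t j i = x t j"
    and agree: "(\<lambda>t. honest_diameter H x t) \<longlonglongrightarrow> 0"
    and far: "\<And>t k. t \<ge> T \<Longrightarrow> k \<in> nbrs E i - H \<Longrightarrow>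
                \<gamma> \<le> infnorm (msg t k i - honest_mean H x t)"
    and \<eta>: "\<eta> > 0" and lam: "0 \<le> lam" "lam < 1"
    and \<gamma>: "(1 - lam) / (\<eta> * real (honest_degree E H i)) < \<gamma>"
  shows "eventually (\<lambda>t. \<forall>k\<in>nbrs E i - H. weight E msg \<eta> lam t i k = 0) sequentially"
    and "j \<in> nbrs E i \<inter> H \<Longrightarrow>
           (\<lambda>t. weight E msg \<eta> lam t i j) \<longlonglongrightarrow> 1 / real (honest_degree E H i)"
proof -
  let ?A = "nbrs E i" and ?S = "nbrs E i \<inter> H"
  let ?L = "\<lambda>t j. cum_loss E msg lam t i j" and ?l = "\<lambda>t j. loss E msg t i j"
  let ?\<Delta> = "honest_diameter H x"
  define cm where "cm t = coord_median ?A (\<lambda>j. msg t j i)" for t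
  define d where "d = real (card ?S)"
  have d: "d = real (honest_degree E H i)" and "d > 0"
    using majority by (simp_all add: d_def honest_degree_def)
  have S: "?S \<subseteq> ?A" "?S \<noteq> {}" "?A - ?S = ?A - H"
    using \<open>d > 0\<close> by (auto simp: d_def)
  have rec: "?L (Suc t) j = lam * ?L t j + ?l (Suc t) j" for t j
    by simp
  have cm_near: "infnorm (cm t - w) \<le> ?\<Delta> t"
    if "\<And>j. j \<in> ?S \<Longrightarrow> infnorm (x t j - w) \<le> ?\<Delta> t" for t w
    unfolding cm_def using fin(1) S majority that honest_msg
    by (intro infnorm_coord_median_le[where G = ?S]) auto

  have honest_lim: "(\<lambda>t. - \<eta> * ?L t j) \<longlonglongrightarrow> 0" if j: "j \<in> ?S" for j
  proof -
    have "?l t j \<le> ?\<Delta> t" for t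
    proof -
      have "infnorm (cm t - x t j) \<le> ?\<Delta> t"
        using j fin(2) by (intro cm_near infnorm_diff_le_honest_diameter) auto
      then show ?thesis
        using honest_msg[OF j] by (simp add: loss_def infnorm_sub flip: cm_def)
    qed
    then have "(\<lambda>t. ?l t j) \<longlonglongrightarrow> 0"
      by (intro tendsto_sandwich[OF _ _ tendsto_const agree] always_eventually allI)
        (simp add: loss_def infnorm_pos_le)
    then have "(\<lambda>t. ?L t j) \<longlonglongrightarrow> 0"
      by (rule discounted_tendsto_0[where u = "\<lambda>t. ?L t j" and v = "\<lambda>t. ?l t j", OF rec lam])
    then show ?thesis
      by (rule tendsto_mult_right_zero)
  qed

  \<comment> \<open>Strict room on both sides of \<open>K\<close>: the Byzantine scores must end up strictly below the
      limit of the threshold, and the vanishing \<open>\<Delta>\<close> must not eat up the gap to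
      \<open>\<gamma>\<close>.\<close>
  have "1 / (\<eta> * d) < \<gamma> / (1 - lam)"
    using \<gamma> lam \<eta> \<open>d > 0\<close> by (simp add: d[symmetric] field_simps)
  then obtain K where K: "1 / (\<eta> * d) < K" "K < \<gamma> / (1 - lam)"
    using dense by blast
  then have "K * (1 - lam) < \<gamma>"
    using lam by (simp add: field_simps)
  then obtain c where c: "K * (1 - lam) < c" "c < \<gamma>"
    using dense by blast

  have byz: "eventually (\<lambda>t. - \<eta> * ?L t k < - \<eta> * K) sequentially" if k: "k \<in> ?A - ?S" for k
  proof -
    have "eventually (\<lambda>t. ?\<Delta> t < \<gamma> - c) sequentially"
      using agree c(2) by (intro order_tendstoD) auto
    then have "eventually (\<lambda>t. c \<le> ?l t k) sequentially"
      using eventually_ge_at_top[of T]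
    proof eventually_elim
      case (elim t)
      let ?mean = "honest_mean H x t"
      have "\<gamma> \<le> infnorm ((msg t k i - cm t) + (cm t - ?mean))"
        using far[of t k] elim k by simp
      also have "\<dots> \<le> ?l t k + infnorm (cm t - ?mean)"
        unfolding loss_def cm_def[symmetric] by (rule infnorm_triangle)
      also have "infnorm (cm t - ?mean) \<le> ?\<Delta> t"
        using fin(2) by (intro cm_near infnorm_diff_honest_mean_le) auto
      finally show ?case
        using elim by simp
    qed
    then have "eventually (\<lambda>t. K < ?L t k) sequentially"
      by (rule discounted_eventually_gt[where u = "\<lambda>t. ?L t k" and v = "\<lambda>t. ?l t k",
            OF rec lam _ c(1)])
    then show ?thesis
      using \<eta> by (auto elim: eventually_mono)
  qed
  have level: "- \<eta> * K < - (1 / real (card ?S))"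
    using K(1) \<eta> \<open>d > 0\<close> by (simp add: field_simps flip: d_def)

  note limits = eventually_sparsemax_supported[OF fin(1) S(1,2) honest_lim byz level]
  show "eventually (\<lambda>t. \<forall>k\<in>?A - H. weight E msg \<eta> lam t i k = 0) sequentially"
    using limits(1) by (simp add: weight_def S(3))
  show "(\<lambda>t. weight E msg \<eta> lam t i j) \<longlonglongrightarrow> 1 / real (honest_degree E H i)" if "j \<in> ?S"
    using limits(2)[OF _ _ that] by (simp add: weight_def honest_degree_def)
qed

section \<open>The network\<close>

theorem proposition2:
  fixes n :: nat and E :: "nat rel" and H B :: "nat set"
    and \<alpha> \<eta> lam \<gamma> :: real and T :: nat
    and x :: "nat \<Rightarrow> nat \<Rightarrow> real ^ 'd"
    and msg :: "nat \<Rightarrow> nat \<Rightarrow> nat \<Rightarrow> real ^ 'd"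
  assumes "simple_graph {1..n} E"
    and "connected_graph {1..n} E"
    and "H \<union> B = {1..n}" and "H \<inter> B = {}" and "H \<noteq> {}"
    and "\<forall>i\<in>H. card (nbrs E i \<inter> H) > card (nbrs E i \<inter> B)"
    and "0 < \<alpha>" and "\<alpha> \<le> 1" and "\<eta> > 0" and "0 \<le> lam" and "lam < 1"
    and "A_RepC_run E H \<alpha> \<eta> lam x msg"
    and "(\<lambda>t. honest_diameter H x t) \<longlonglongrightarrow> 0"
    and "\<gamma> > 0"
    and "\<forall>t\<ge>T. \<forall>i\<in>H. \<forall>k \<in> nbrs E i \<inter> B. infnorm (msg t k i - honest_mean H x t) \<ge> \<gamma>"
    and "\<gamma> > (1 - lam) / (\<eta> * real (min_honest_degree E H))"
  shows "(\<exists>T'\<ge>T. \<forall>t\<ge>T'. \<forall>i\<in>H. \<forall>k \<in> nbrs E i \<inter> B. weight E msg \<eta> lam t i k = 0) \<and>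
         (\<forall>i\<in>H. \<forall>j \<in> nbrs E i \<inter> H.
            (\<lambda>t. weight E msg \<eta> lam t i j) \<longlonglongrightarrow> 1 / real (honest_degree E H i))"
proof -
  have finH: "finite H"
    using assms(3) by (metis finite_Un finite_atLeastAtMost)
  have nbrs: "finite (nbrs E i)" "nbrs E i - H = nbrs E i \<inter> B" for i
  proof -
    have sub: "nbrs E i \<subseteq> {1..n}"
      using assms(1) by (auto simp: simple_graph_def nbrs_def)
    then show "finite (nbrs E i)"
      by (rule finite_subset) simp
    show "nbrs E i - H = nbrs E i \<inter> B"
      using sub assms(3,4) by blast
  qed
  have \<gamma>_node: "(1 - lam) / (\<eta> * real (honest_degree E H i)) < \<gamma>" if "i \<in> H" for i
  proof -
    have "min_honest_degree E H \<in> honest_degree E H ` H"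
      unfolding min_honest_degree_def using finH assms(5) by (intro Min_in) auto
    then have "0 < min_honest_degree E H"
      using assms(6) by (fastforce simp: honest_degree_def)
    moreover have "min_honest_degree E H \<le> honest_degree E H i"
      unfolding min_honest_degree_def using finH that by simp
    ultimately have "(1 - lam) / (\<eta> * real (honest_degree E H i))
        \<le> (1 - lam) / (\<eta> * real (min_honest_degree E H))"
      using assms(9,11) by (intro divide_left_mono mult_left_mono mult_pos_pos) auto
    then show ?thesis
      using assms(16) by linarith
  qed
  have node: "eventually (\<lambda>t. \<forall>k\<in>nbrs E i \<inter> B. weight E msg \<eta> lam t i k = 0) sequentially"
    "\<forall>j \<in> nbrs E i \<inter> H. (\<lambda>t. weight E msg \<eta> lam t i j) \<longlonglongrightarrow> 1 / real (honest_degree E H i)"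
    if i: "i \<in> H" for i
  proof -
    have majority: "card (nbrs E i - H) < card (nbrs E i \<inter> H)"
      using assms(6) i by (simp add: nbrs)
    have honest_msg: "msg t j i = x t j" if "j \<in> nbrs E i \<inter> H" for t j
      using assms(12) i that by (simp add: A_RepC_run_def)
    have far: "\<gamma> \<le> infnorm (msg t k i - honest_mean H x t)"
      if "t \<ge> T" "k \<in> nbrs E i - H" for t k
      using assms(15) i that by (simp add: nbrs)
    note weights = weights_at_honest_node[where msg = msg and x = x and i = i,
        OF nbrs(1) finH majority honest_msg assms(13) far
        assms(9-11) \<gamma>_node[OF i]]
    from weights show "eventually (\<lambda>t. \<forall>k\<in>nbrs E i \<inter> B. weight E msg \<eta> lam t i k = 0) sequentially"
      "\<forall>j \<in> nbrs E i \<inter> H. (\<lambda>t. weight E msg \<eta> lam t i j) \<longlonglongrightarrow> 1 / real (honest_degree E H i)"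
      by (auto simp: nbrs)
  qed
  have "eventually (\<lambda>t. \<forall>i\<in>H. \<forall>k\<in>nbrs E i \<inter> B. weight E msg \<eta> lam t i k = 0) sequentially"
    using finH node(1) by (intro eventually_ball_finite) auto
  then obtain N where "\<forall>t\<ge>N. \<forall>i\<in>H. \<forall>k\<in>nbrs E i \<inter> B. weight E msg \<eta> lam t i k = 0"
    by (auto simp: eventually_sequentially)
  then have "\<exists>T'\<ge>T. \<forall>t\<ge>T'. \<forall>i\<in>H. \<forall>k \<in> nbrs E i \<inter> B. weight E msg \<eta> lam t i k = 0"
    by (intro exI[of _ "max N T"]) simp
  then show ?thesis
    using node(2) by blast
qed

end
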